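(* For a crystallographic point group $G$ and lattices $\Lambda_1,\Lambda_2$ in $\mathbb{R}^2$, we have $$|\mathrm{RC}[G](\Lambda_1)-\mathrm{RC}[G](\Lambda_2)|\leq\mathrm{RM}(\Lambda_1,\Lambda_2)\quad\text{and}\quad|\mathrm{PC}[G](\Lambda_1)-\mathrm{PC}[G](\Lambda_2)|\leq\mathrm{PM}(\Lambda_1,\Lambda_2)$$ for any metrics $\mathrm{RM}$ and $\mathrm{PM}$.
   Context: A lattice $\Lambda\subset\mathbb{R}^2$ is the set of all integer linear combinations of a linear basis. A superbase of $\Lambda$ is a triple $\{v_0,v_1,v_2\}$, where $v_1,v_2$ is a basis generating $\Lambda$ and $v_0=-v_1-v_2$; it is obtuse if all $p_{ij}=-v_i\cdot v_j\geq 0$ for $i\neq j$. Every lattice in $\mathbb{R}^2$ has an obtuse superbase. The root invariant $\mathrm{RI}(\Lambda)=(r_{12},r_{01},r_{02})$, $r_{12}\leq r_{01}\leq r_{02}$, is the triple of root products $\sqrt{p_{ij}}$ of an obtuse superbase in increasing order (independent of the choice of obtuse superbase). With $\bar r_{ij}=r_{ij}/(r_{12}+r_{01}+r_{02})$, the projected invariant is $\mathrm{PI}(\Lambda)=(\bar r_{02}-\bar r_{01},\,3\bar r_{12})$. For a metric $d$ on $\mathbb{R}^3$, the root metric is $\mathrm{RM}(\Lambda,\Lambda')=d(\mathrm{RI}(\Lambda),\mathrm{RI}(\Lambda'))$. For a metric $d$ on $\mathbb{R}^2$, the projected metric is $\mathrm{PM}(\Lambda,\Lambda')=d(\mathrm{PI}(\Lambda),\mathrm{PI}(\Lambda'))$.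 For a crystallographic point group $G$ in $\mathbb{R}^2$, $\mathrm{LIS}[G]$ is the closure of the subspace of all (isometry classes of) lattices that have the point group $G$. For $G=D_2$, $D_4$ or $D_6$, the root and projected $G$-chiral distances, defined by the chosen metrics $\mathrm{RM}$ and $\mathrm{PM}$, are $$\mathrm{RC}[G](\Lambda)=\min_{\Lambda'\in\mathrm{LIS}[G]}\mathrm{RM}(\Lambda,\Lambda'),\qquad \mathrm{PC}[G](\Lambda)=\min_{\Lambda'\in\mathrm{LIS}[G]}\mathrm{PM}(\Lambda,\Lambda').$$ Explicitly, $\mathrm{LIS}[D_2]$ consists of all mirror-symmetric lattices (mapped to themselves by a reflection in a line), $\mathrm{LIS}[D_4]$ of all square lattices, $\mathrm{LIS}[D_6]$ of all hexagonal lattices. *)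

theory Defs
  imports "HOL-Analysis.Analysis"
begin

definition lattice_basis :: "real^2 \<Rightarrow> real^2 \<Rightarrow> bool" where
  "lattice_basis v w \<longleftrightarrow> v \<noteq> w \<and> independent {v, w} \<and> span {v, w} = UNIV"

definition lattice_of :: "real^2 \<Rightarrow> real^2 \<Rightarrow> (real^2) set" where
  "lattice_of v w = {of_int a *\<^sub>R v + of_int b *\<^sub>R w | a b. True}"

definition is_lattice :: "(real^2) set \<Rightarrow> bool" where
  "is_lattice L \<longleftrightarrow> (\<exists>v w. lattice_basis v w \<and> L = lattice_of v w)"

definition superbase :: "(real^2) set \<Rightarrow> real^2 \<Rightarrow> real^2 \<Rightarrow> real^2 \<Rightarrow> bool" where
  "superbase L v0 v1 v2 \<longleftrightarrow>
     lattice_basis v1 v2 \<and> L = lattice_of v1 v2 \<and> v0 = - v1 - v2"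

definition obtuse_superbase :: "(real^2) set \<Rightarrow> real^2 \<Rightarrow> real^2 \<Rightarrow> real^2 \<Rightarrow> bool" where
  "obtuse_superbase L v0 v1 v2 \<longleftrightarrow>
     superbase L v0 v1 v2 \<and> - (v1 \<bullet> v2) \<ge> 0 \<and> - (v0 \<bullet> v1) \<ge> 0 \<and> - (v0 \<bullet> v2) \<ge> 0"

text \<open>Every lattice has an obtuse superbase and the sorted triple of root products does not
  depend on its choice, so the definite description below is well defined. After sorting, the
  components 1, 2, 3 are the ones labelled r12, r01, r02.\<close>

definition RI :: "(real^2) set \<Rightarrow> real^3" where
  "RI L = (THE r. \<exists>v0 v1 v2. obtuse_superbase L v0 v1 v2 \<and>
     r = vector (sort [sqrt (- (v1 \<bullet> v2)), sqrt (- (v0 \<bullet> v1)), sqrt (- (v0 \<bullet> v2))]))"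

definition PI :: "(real^2) set \<Rightarrow> real^2" where
  "PI L = (let r12 = RI L $ 1; r01 = RI L $ 2; r02 = RI L $ 3; s = r12 + r01 + r02
           in vector [r02 / s - r01 / s, 3 * (r12 / s)])"

definition RM :: "(real^3 \<Rightarrow> real^3 \<Rightarrow> real) \<Rightarrow> (real^2) set \<Rightarrow> (real^2) set \<Rightarrow> real" where
  "RM d L L' = d (RI L) (RI L')"

definition PM :: "(real^2 \<Rightarrow> real^2 \<Rightarrow> real) \<Rightarrow> (real^2) set \<Rightarrow> (real^2) set \<Rightarrow> real" where
  "PM d L L' = d (PI L) (PI L')"

definition point_group :: "(real^2) set \<Rightarrow> (real^2 \<Rightarrow> real^2) set" where
  "point_group L = {f. orthogonal_transformation f \<and> f ` L = L}"

text \<open>Finiteness need not be required: the point group of a lattice is finite.\<close>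

definition crystallographic_point_group :: "(real^2 \<Rightarrow> real^2) set \<Rightarrow> bool" where
  "crystallographic_point_group G \<longleftrightarrow>
     (\<exists>L. is_lattice L \<and> G \<subseteq> point_group L) \<and>
     id \<in> G \<and> (\<forall>f\<in>G. \<forall>g\<in>G. f \<circ> g \<in> G) \<and> (\<forall>f\<in>G. inv f \<in> G)"

text \<open>Point groups are identified up to conjugation by an orthogonal map, so that the notion
  depends only on the isometry class of the lattice.\<close>

definition has_point_group :: "(real^2) set \<Rightarrow> (real^2 \<Rightarrow> real^2) set \<Rightarrow> bool" where
  "has_point_group L G \<longleftrightarrow>
     (\<exists>q. orthogonal_transformation q \<and> point_group L = (\<lambda>g. q \<circ> g \<circ> inv q) ` G)"

text \<open>The closure is taken in the space of lattices up to isometry, that is, the quotient of the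
  space of bases (pairs of vectors) by change of basis and by orthogonal maps. The quotient
  map is open, so a lattice lies in the closure iff one (equivalently, every) basis of it is in
  the closure of the set of all bases of lattices with point group \<open>G\<close>. An isometry class is
  represented by all the lattices in it.\<close>

definition LIS :: "(real^2 \<Rightarrow> real^2) set \<Rightarrow> (real^2) set set" where
  "LIS G = {lattice_of v w | v w. lattice_basis v w \<and>
     (v, w) \<in> closure {(v', w'). lattice_basis v' w' \<and> has_point_group (lattice_of v' w') G}}"

text \<open>Since the metric is arbitrary (it need not induce the Euclidean topology), the minimum may
  fail to be attained; the infimum agrees with the minimum whenever the latter exists. Up to
  conjugation, \<open>LIS G\<close> is nonempty exactly for the groups C2, D2, D4, D6.\<close>

definition RC :: "(real^3 \<Rightarrow> real^3 \<Rightarrow> real) \<Rightarrow> (real^2 \<Rightarrow> real^2) set \<Rightarrow> (real^2) set \<Rightarrow> real" where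
  "RC d G L = (INF L'\<in>LIS G. RM d L L')"

definition PC :: "(real^2 \<Rightarrow> real^2 \<Rightarrow> real) \<Rightarrow> (real^2 \<Rightarrow> real^2) set \<Rightarrow> (real^2) set \<Rightarrow> real" where
  "PC d G L = (INF L'\<in>LIS G. PM d L L')"

end

theory Submission
  imports Defs
begin

text \<open>The distance to a fixed set is 1-Lipschitz in any metric space: take the infimum over z
  in \<open>d x z \<le> d x y + d y z\<close>, then swap x and y. \<open>RC\<close> and
  \<open>PC\<close> are such distances, from \<open>RI L\<close> and \<open>PI L\<close> to the
  images of \<open>LIS G\<close>.\<close>

lemma (in Metric_space) abs_INF_dist_diff_le:
  assumes x: "x \<in> M" and y: "y \<in> M" and f: "f ` S \<subseteq> M"
  shows "\<bar>(INF s\<in>S. d x (f s)) - (INF s\<in>S. d y (f s))\<bar> \<le> d x y"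
proof (cases "S = {}")
  case True
  \<comment> \<open>Both infima are the same default value \<open>Inf {}\<close>, so they cancel;
    this covers groups with empty \<open>LIS G\<close>.\<close>
  then show ?thesis by simp
next
  case False
  have le: "(INF s\<in>S. d a (f s)) \<le> d a b + (INF s\<in>S. d b (f s))"
    if a: "a \<in> M" and b: "b \<in> M" for a b
  proof -
    have "(INF s\<in>S. d a (f s)) - d a b \<le> (INF s\<in>S. d b (f s))"
    proof (rule cINF_greatest [OF False])
      fix s assume s: "s \<in> S"
      \<comment> \<open>Over the reals, \<open>Inf\<close> is known to be a lower bound only of sets
        bounded below; here 0 bounds all distances.\<close>
      have "bdd_below ((\<lambda>s. d a (f s)) ` S)"
        by (rule bdd_belowI2 [where m = 0]) simp
      then have "(INF s\<in>S. d a (f s)) \<le> d a (f s)"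
        using s by (rule cINF_lower)
      also have "\<dots> \<le> d a b + d b (f s)"
        using triangle [OF a b] f s by blast
      finally show "(INF s\<in>S. d a (f s)) - d a b \<le> d b (f s)"
        by simp
    qed
    then show ?thesis by simp
  qed
  show ?thesis
    using le [OF x y] le [OF y x] commute [of x y] by linarith
qed

theorem proposition7p10:
  fixes G :: "(real^2 \<Rightarrow> real^2) set"
    and d3 :: "real^3 \<Rightarrow> real^3 \<Rightarrow> real"
    and d2 :: "real^2 \<Rightarrow> real^2 \<Rightarrow> real"
    and L1 L2 :: "(real^2) set"
  assumes "crystallographic_point_group G"
    and "is_lattice L1" and "is_lattice L2"
    and "Metric_space UNIV d3"
    and "Metric_space UNIV d2"
  shows "\<bar>RC d3 G L1 - RC d3 G L2\<bar> \<le> RM d3 L1 L2 \<and>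
         \<bar>PC d2 G L1 - PC d2 G L2\<bar> \<le> PM d2 L1 L2"
  unfolding RC_def RM_def PC_def PM_def
  \<comment> \<open>Here \<open>f\<close> is \<open>RI\<close> or \<open>PI\<close> and
    \<open>S\<close> is \<open>LIS G\<close>; the side conditions are membership in
    \<open>UNIV\<close>.\<close>
  by (intro conjI Metric_space.abs_INF_dist_diff_le [OF assms(4)]
      Metric_space.abs_INF_dist_diff_le [OF assms(5)]) simp_all

end
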